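(* (i) There exist arbitrarily large finite sets $S\subset\mathbb R^2$, not contained in a conic and with no four points on a line, that determine at most $\frac{1}{24}|S|^4$ ordinary conics. (ii) There is an absolute constant $C$ and arbitrarily large finite sets $S\subset\mathbb R^2$, not contained in a conic and with at most $|S|/2$ points on any line, that determine at most $\frac{7}{384}|S|^4+C|S|^3$ ordinary conics.
   Context: A conic is the zero set in $\mathbb R^2$ of a real polynomial of degree $2$ in two variables; in particular a union of two distinct lines is a conic. A conic is an ordinary conic for a finite set $S\subset\mathbb R^2$ (and $S$ is said to determine it) if it contains exactly five points of $S$ and it is the only conic containing these five points. *)

theory Defs
  imports "HOL-Analysis.Analysis"
begin

text \<open>The general bivariate real polynomial of degree at most 2 is written out by its
  coefficients; its degree is exactly 2 iff one of the three quadratic coefficients is nonzero.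
  Conics are sets, not polynomials: a double line, a single point and the empty set are
  (degenerate) conics.\<close>

definition is_conic :: "(real \<times> real) set \<Rightarrow> bool" where
  "is_conic K \<longleftrightarrow>
    (\<exists>a b c d e f :: real. (a \<noteq> 0 \<or> b \<noteq> 0 \<or> c \<noteq> 0) \<and>
      K = {(x, y). a * x\<^sup>2 + b * x * y + c * y\<^sup>2 + d * x + e * y + f = 0})"

definition is_line :: "(real \<times> real) set \<Rightarrow> bool" where
  "is_line L \<longleftrightarrow> affine L \<and> aff_dim L = 1"

definition ordinary_conic :: "(real \<times> real) set \<Rightarrow> (real \<times> real) set \<Rightarrow> bool" where
  "ordinary_conic S K \<longleftrightarrow>
    is_conic K \<and> card (K \<inter> S) = 5 \<and> (\<forall>K'. is_conic K' \<and> K \<inter> S \<subseteq> K' \<longrightarrow> K' = K)"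

definition ordinary_conics :: "(real \<times> real) set \<Rightarrow> (real \<times> real) set set" where
  "ordinary_conics S = {K. ordinary_conic S K}"

text \<open>An ordinary conic is determined by its five points in \<^term>\<open>S\<close>, so for finite \<^term>\<open>S\<close> the
  \<^const>\<open>card\<close> of \<^term>\<open>ordinary_conics S\<close> is not the default value of an infinite set.\<close>

lemma finite_ordinary_conics:
  assumes "finite S"
  shows "finite (ordinary_conics S)"
proof (rule inj_on_finite)
  show "inj_on (\<lambda>K. K \<inter> S) (ordinary_conics S)"
  proof (rule inj_onI)
    fix K K' assume "K \<in> ordinary_conics S" "K' \<in> ordinary_conics S" "K \<inter> S = K' \<inter> S"
    then show "K = K'"
      unfolding ordinary_conics_def ordinary_conic_def by blast
  qed
  show "(\<lambda>K. K \<inter> S) ` ordinary_conics S \<subseteq> Pow S" by blast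
  show "finite (Pow S)" using assms by simp
qed

end

theory Submission
  imports Defs "HOL-Computational_Algebra.Fundamental_Theorem_Algebra"
begin

text \<open>A conic meets a plane cubic in six points whose sum, in the group of the cubic, vanishes. If
  the parameters of \<open>S\<close> form a finite subgroup, the sixth point of a conic through five points of
  \<open>S\<close> is again in \<open>S\<close>, so an ordinary conic touches the cubic at one of its five points. When the
  order is odd, doubling is injective and the point of contact is determined by the other four.

  For (i) take the acnodal cubic \<open>x\<^sup>3 - 3 x y\<^sup>2 = x\<^sup>2 + y\<^sup>2\<close>, whose group is the unit circle. For
  (ii) take the hyperbola \<open>x\<^sup>2 - y\<^sup>2 = 1\<close> with the line \<open>x = 0\<close>, projectively a circle with the line at
  infinity. With \<open>n\<close> points on each component, at most \<open>n choose 4\<close> ordinary conics touch the line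
  and at most \<open>(n choose 2)\<^sup>2\<close> touch the hyperbola; note \<open>1 / 24 + 1 / 4 = 2\<^sup>4 * 7 / 384\<close>.

  In angular coordinates the restriction of a conic to a component is a trigonometric polynomial,
  and the group law is Vieta's formula for the product of its zeros on the unit circle.\<close>

section \<open>Trigonometric polynomials\<close>

text \<open>On the unit circle the real trigonometric polynomials are the functions \<open>Re (poly q z)\<close>: the
  coefficient \<open>\<alpha> - \<i> \<beta>\<close> of \<open>z\<^sup>k\<close> contributes \<open>\<alpha> cos k\<theta> + \<beta> sin k\<theta>\<close> at \<open>z = e\<^sup>i\<^sup>\<theta>\<close>.\<close>

definition circle_zeros :: "complex poly \<Rightarrow> complex set" where
  "circle_zeros q = {z \<in> sphere 0 1. Re (poly q z) = 0}"

definition self_reciprocal_poly :: "complex poly \<Rightarrow> complex poly" where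
  "self_reciprocal_poly q = monom 1 (degree q) * q + reflect_poly (map_poly cnj q)"

lemma poly_self_reciprocal_poly:
  assumes "norm z = 1"
  shows "poly (self_reciprocal_poly q) z = z ^ degree q * of_real (2 * Re (poly q z))"
proof -
  have "z \<noteq> 0" "inverse z = cnj z"
    using assms by (auto simp: inverse_complex_def complex_eq_iff cmod_def)
  then have "poly (self_reciprocal_poly q) z = z ^ degree q * (poly q z + cnj (poly q z))"
    by (simp add: self_reciprocal_poly_def poly_monom poly_reflect_poly_nz degree_map_poly algebra_simps)
  then show ?thesis
    by (simp add: complex_add_cnj)
qed

lemma poly_self_reciprocal_poly_eq_0:
  "z \<in> circle_zeros q \<Longrightarrow> poly (self_reciprocal_poly q) z = 0"
  by (simp add: circle_zeros_def poly_self_reciprocal_poly)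

lemma
  assumes "0 < degree q"
  shows degree_self_reciprocal_poly: "degree (self_reciprocal_poly q) = 2 * degree q"
    and lead_coeff_self_reciprocal_poly: "lead_coeff (self_reciprocal_poly q) = lead_coeff q"
    and coeff_0_self_reciprocal_poly: "coeff (self_reciprocal_poly q) 0 = cnj (lead_coeff q)"
proof -
  have cnj: "degree (map_poly cnj q) = degree q"
    by (simp add: degree_map_poly)
  have reflect: "degree (reflect_poly (map_poly cnj q)) < 2 * degree q"
    using degree_reflect_poly_le[of "map_poly cnj q"] assms unfolding cnj by linarith
  moreover have "degree (monom 1 (degree q) * q) = 2 * degree q"
    using assms by (subst degree_mult_eq) (auto simp: degree_monom_eq)
  ultimately show degree: "degree (self_reciprocal_poly q) = 2 * degree q"
    by (simp add: self_reciprocal_poly_def degree_add_eq_left)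
  show "lead_coeff (self_reciprocal_poly q) = lead_coeff q"
    using reflect unfolding degree
    by (simp add: self_reciprocal_poly_def coeff_monom_mult coeff_eq_0 mult_2)
  show "coeff (self_reciprocal_poly q) 0 = cnj (lead_coeff q)"
    using assms by (simp add: self_reciprocal_poly_def coeff_monom_mult cnj coeff_map_poly)
qed

lemma card_circle_zeros_le_if_degree_pos:
  assumes "0 < degree q" "A \<subseteq> circle_zeros q"
  shows "card A \<le> 2 * degree q"
proof -
  let ?P = "self_reciprocal_poly q"
  have "?P \<noteq> 0"
    using degree_self_reciprocal_poly[OF assms(1)] assms(1) by auto
  then have roots: "finite {z. poly ?P z = 0}" "card {z. poly ?P z = 0} \<le> 2 * degree q"
    using poly_roots_finite card_poly_roots_bound[of ?P]
    by (simp_all add: degree_self_reciprocal_poly assms(1))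
  have subset: "A \<subseteq> {z. poly ?P z = 0}"
    using assms(2) poly_self_reciprocal_poly_eq_0 by auto
  show ?thesis
    using card_mono[OF roots(1) subset] roots(2) by (rule order_trans)
qed

lemma circle_zeros_eq_sphere_iff:
  "circle_zeros q = sphere 0 1 \<longleftrightarrow> degree q = 0 \<and> Re (coeff q 0) = 0"
proof
  assume sphere: "circle_zeros q = sphere 0 1"
  have "degree q = 0"
  proof (rule ccontr)
    let ?n = "Suc (2 * degree q)"
    assume "degree q \<noteq> 0"
    moreover have "{z. z ^ ?n = 1} \<subseteq> circle_zeros q"
      unfolding sphere by (auto dest: power_eq_1_iff simp del: power_Suc)
    ultimately have "card {z::complex. z ^ ?n = 1} \<le> 2 * degree q"
      by (intro card_circle_zeros_le_if_degree_pos) auto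
    then show False
      by (simp add: card_roots_unity_eq del: power_Suc)
  qed
  moreover have "1 \<in> circle_zeros q"
    unfolding sphere by simp
  ultimately show "degree q = 0 \<and> Re (coeff q 0) = 0"
    by (simp add: circle_zeros_def poly_altdef)
qed (auto simp: circle_zeros_def poly_altdef)

lemma card_circle_zeros_le:
  assumes "circle_zeros q \<noteq> sphere 0 1" "A \<subseteq> circle_zeros q"
  shows "card A \<le> 2 * degree q"
proof (cases "degree q = 0")
  case True
  then have "circle_zeros q = {}"
    using assms(1) unfolding circle_zeros_eq_sphere_iff by (auto simp: circle_zeros_def poly_altdef)
  with assms(2) show ?thesis by simp
next
  case False
  with assms(2) show ?thesis
    by (intro card_circle_zeros_le_if_degree_pos) auto
qed

lemma coeff_0_eq_prod_proots:
  fixes p :: "complex poly"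
  shows "coeff p 0 = (-1) ^ degree p * lead_coeff p * prod_mset (proots p)"
proof -
  have "coeff p 0 = lead_coeff p * (\<Prod>x\<in>#proots p. - x)"
    by (subst complex_poly_decompose_multiset[of p, symmetric])
      (simp add: poly_0_coeff_0[symmetric] poly_prod_mset multiset.map_comp o_def)
  also have "(\<Prod>x\<in>#M. - x) = (-1) ^ size M * prod_mset M" for M :: "complex multiset"
    by (induction M) auto
  finally show ?thesis
    by (simp add: size_proots_complex)
qed

lemma circle_zeros_Vieta:
  assumes "0 < degree q" "A \<subseteq> circle_zeros q"
  obtains R where "size R + card A = 2 * degree q"
    "lead_coeff q * (prod_mset R * \<Prod>A) = cnj (lead_coeff q)"
    "\<And>r. r \<in># R \<Longrightarrow> norm r = 1 \<Longrightarrow> r \<in> circle_zeros q"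
proof -
  let ?P = "self_reciprocal_poly q"
  note degree = degree_self_reciprocal_poly[OF assms(1)]
    and lead_coeff = lead_coeff_self_reciprocal_poly[OF assms(1)]
    and coeff_0 = coeff_0_self_reciprocal_poly[OF assms(1)]
  have "?P \<noteq> 0"
    using degree assms(1) by auto
  then have roots: "set_mset (proots ?P) = {z. poly ?P z = 0}"
    by (rule set_count_proots)
  then have "A \<subseteq> set_mset (proots ?P)"
    using assms(2) poly_self_reciprocal_poly_eq_0 by auto
  then have "mset_set A \<subseteq># mset_set (set_mset (proots ?P))"
    by (simp add: subset_imp_msubset_mset_set)
  also have "\<dots> \<subseteq># proots ?P"
    by (rule mset_set_set_mset_msubset)
  finally obtain R where R: "proots ?P = R + mset_set A"
    by (metis add.commute mset_subset_eq_exists_conv)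
  show thesis
  proof (rule that)
    show "size R + card A = 2 * degree q"
      using size_proots_complex[of ?P] unfolding R degree by simp
    show "lead_coeff q * (prod_mset R * \<Prod>A) = cnj (lead_coeff q)"
      using coeff_0_eq_prod_proots[of ?P] unfolding lead_coeff coeff_0 unfolding degree R
      by (simp add: prod_unfold_prod_mset)
    show "r \<in> circle_zeros q" if "r \<in># R" "norm r = 1" for r
    proof -
      have "poly ?P r = 0"
        using that(1) roots R by auto
      with that(2) show ?thesis
        by (auto simp: circle_zeros_def poly_self_reciprocal_poly)
    qed
  qed
qed

lemma prod_circle_zeros:
  assumes "0 < degree q" "A \<subseteq> circle_zeros q" "card A = 2 * degree q"
  shows "lead_coeff q * \<Prod>A = cnj (lead_coeff q)"
proof -
  obtain R where R: "size R + card A = 2 * degree q"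
    "lead_coeff q * (prod_mset R * \<Prod>A) = cnj (lead_coeff q)"
    by (rule circle_zeros_Vieta[OF assms(1,2)])
  then have "R = {#}"
    using assms(3) by simp
  with R(2) show ?thesis by simp
qed

lemma last_circle_zero:
  assumes "A \<subseteq> circle_zeros q" "Suc (card A) = 2 * degree q"
  obtains r where "r \<in> circle_zeros q" "lead_coeff q * (r * \<Prod>A) = cnj (lead_coeff q)"
proof -
  have deg: "0 < degree q"
    using assms(2) by linarith
  obtain R where size: "size R + card A = 2 * degree q"
    and prod: "lead_coeff q * (prod_mset R * \<Prod>A) = cnj (lead_coeff q)"
    and zeros: "\<And>r. r \<in># R \<Longrightarrow> norm r = 1 \<Longrightarrow> r \<in> circle_zeros q"
    using circle_zeros_Vieta[OF deg assms(1)] by blast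
  obtain r where R: "R = {#r#}"
    using size assms(2) size_1_singleton_mset[of R] by auto
  have "lead_coeff q \<noteq> 0"
    using deg by auto
  moreover have "norm (\<Prod>A) = 1"
    using assms(1) by (auto simp: prod_norm[symmetric] circle_zeros_def intro!: prod.neutral)
  ultimately have "norm r = 1"
    using arg_cong[where f = norm, OF prod] by (simp add: R norm_mult)
  with prod zeros R show thesis
    by (intro that[of r]) auto
qed

section \<open>Conics and lines on parametrised cubics\<close>

lemma is_line_equation:
  assumes "is_line L"
  obtains \<alpha> \<beta> \<gamma> where "\<alpha> \<noteq> 0 \<or> \<beta> \<noteq> 0" "L = {(x, y). \<alpha> * x + \<beta> * y = \<gamma>}"
proof -
  have "aff_dim L = int (DIM(real \<times> real) - 1)" "affine hull L = L"
    using assms by (auto simp: is_line_def)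
  then obtain w \<gamma> where w: "w \<noteq> 0" "L = {x. w \<bullet> x = \<gamma>}"
    using aff_dim_eq_hyperplane by metis
  obtain \<alpha> \<beta> where "w = (\<alpha>, \<beta>)"
    by (cases w)
  with w show thesis
    by (intro that[of \<alpha> \<beta> \<gamma>]) (auto simp: zero_prod_def)
qed

lemma is_line_Int_y_axis:
  assumes "is_line L"
  obtains "L = {0} \<times> UNIV" | y where "L \<inter> {0} \<times> UNIV \<subseteq> {(0, y)}"
proof -
  obtain \<alpha> \<beta> \<gamma> where nonzero: "\<alpha> \<noteq> 0 \<or> \<beta> \<noteq> 0" and L: "L = {(x, y). \<alpha> * x + \<beta> * y = \<gamma>}"
    by (rule is_line_equation[OF assms])
  show thesis
  proof (cases "\<beta> = 0 \<and> \<gamma> = 0")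
    case True
    with nonzero have "L = {0} \<times> UNIV"
      by (auto simp: L)
    then show thesis by (rule that(1))
  next
    case False
    then have "L \<inter> {0} \<times> UNIV \<subseteq> {(0, \<gamma> / \<beta>)}"
      by (auto simp: L field_simps)
    then show thesis by (rule that(2))
  qed
qed

definition tan_half :: "complex \<Rightarrow> real" where
  "tan_half z = Im z / (1 + Re z)"

lemma tan_half_identities:
  assumes "norm z = 1" "z \<noteq> -1"
  shows "1 + Re z \<noteq> 0" "Im z = (1 + Re z) * tan_half z" "1 - Re z = (1 + Re z) * (tan_half z)\<^sup>2"
proof -
  have circle: "(Re z)\<^sup>2 + (Im z)\<^sup>2 = 1"
    using assms(1) by (simp add: cmod_power2[symmetric])
  show nonzero: "1 + Re z \<noteq> 0"
  proof
    assume "1 + Re z = 0"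
    then have "Re z = -1"
      by linarith
    with circle assms(2) show False
      by (simp add: complex_eq_iff)
  qed
  then show "Im z = (1 + Re z) * tan_half z"
    by (simp add: tan_half_def)
  have "(1 - Re z) * (1 + Re z) = (Im z)\<^sup>2"
    using circle by (simp add: power2_eq_square algebra_simps)
  with nonzero show "1 - Re z = (1 + Re z) * (tan_half z)\<^sup>2"
    by (simp add: tan_half_def power_divide power2_eq_square eq_divide_eq)
qed

lemma tan_half_inject:
  assumes "norm z = 1" "z \<noteq> -1" "norm w = 1" "w \<noteq> -1" "tan_half z = tan_half w"
  shows "z = w"
proof -
  define t where "t = tan_half z"
  have "1 - Re z = (1 + Re z) * t\<^sup>2" "1 - Re w = (1 + Re w) * t\<^sup>2"
    using tan_half_identities(3)[OF assms(1,2)] tan_half_identities(3)[OF assms(3,4)] assms(5)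
    by (simp_all add: t_def)
  then have "(Re z - Re w) * (1 + t\<^sup>2) = 0"
    by (simp add: algebra_simps)
  moreover have "1 + t\<^sup>2 \<noteq> 0"
    by (simp add: add_nonneg_eq_0_iff)
  ultimately have "Re z = Re w"
    by simp
  moreover from this have "Im z = Im w"
    using tan_half_identities(2)[OF assms(1,2)] tan_half_identities(2)[OF assms(3,4)] assms(5) by simp
  ultimately show ?thesis
    by (simp add: complex_eq_iff)
qed

text \<open>The point of the acnodal cubic \<open>x\<^sup>3 - 3 x y\<^sup>2 = x\<^sup>2 + y\<^sup>2\<close>, or \<open>r cos 3\<phi> = 1\<close> in polar
  coordinates, in the direction \<open>\<phi> = \<theta> / 2\<close> for \<open>z = e\<^sup>i\<^sup>\<theta>\<close>.\<close>

definition cubic_point :: "complex \<Rightarrow> real \<times> real" where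
  "cubic_point z = (1 / (2 * Re z - 1), tan_half z / (2 * Re z - 1))"

definition hyperbola_point :: "complex \<Rightarrow> real \<times> real" where
  "hyperbola_point z = (1 / Re z, Im z / Re z)"

definition line_point :: "complex \<Rightarrow> real \<times> real" where
  "line_point z = (0, tan_half z)"

definition hyperbola_line :: "complex set \<times> complex set \<Rightarrow> (real \<times> real) set" where
  "hyperbola_line = (\<lambda>(A, B). hyperbola_point ` A \<union> line_point ` B)"

lemma conic_on_cubic:
  assumes "is_conic K"
  obtains q where "degree q \<le> 3" "coeff q 3 \<in> \<real>" "circle_zeros q \<noteq> sphere 0 1"
    "\<And>z. \<lbrakk>norm z = 1; z \<noteq> -1; Re z \<noteq> 1 / 2\<rbrakk> \<Longrightarrow> cubic_point z \<in> K \<longleftrightarrow> z \<in> circle_zeros q"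
proof -
  obtain a b c d e f where nonzero: "a \<noteq> 0 \<or> b \<noteq> 0 \<or> c \<noteq> 0"
    and K: "K = {(x, y). a * x\<^sup>2 + b * x * y + c * y\<^sup>2 + d * x + e * y + f = 0}"
    using assms unfolding is_conic_def by blast
  let ?q = "[:of_real (a + c + f), Complex (a - c + d) (e - b), Complex d (- e), of_real f:]"
  show thesis
  proof (rule that)
    show "degree ?q \<le> 3" "coeff ?q 3 \<in> \<real>"
      by (simp_all add: eval_nat_numeral)
    show "circle_zeros ?q \<noteq> sphere 0 1"
      using nonzero by (auto simp: circle_zeros_eq_sphere_iff complex_eq_iff split: if_splits)
    fix z assume z: "norm z = 1" "z \<noteq> -1" "Re z \<noteq> 1 / 2"
    define t where "t = tan_half z"
    note t = tan_half_identities[OF z(1,2), folded t_def]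
    define s where "s = 1 / (2 * Re z - 1)"
    have s: "s * (2 * Re z - 1) = 1"
      using z(3) by (simp add: s_def)
    have "Re (poly ?q z) = (1 + Re z) * (2 * Re z - 1)\<^sup>2 *
        (a * s\<^sup>2 + b * s * (t * s) + c * (t * s)\<^sup>2 + d * s + e * (t * s) + f)"
      using t(2,3) s by simp algebra
    then show "cubic_point z \<in> K \<longleftrightarrow> z \<in> circle_zeros ?q"
      using z t(1) by (simp add: circle_zeros_def K cubic_point_def t_def s_def)
  qed
qed

lemma line_on_cubic:
  assumes "is_line L"
  obtains q where "degree q \<le> 2" "circle_zeros q \<noteq> sphere 0 1" "-1 \<in> circle_zeros q"
    "\<And>z. \<lbrakk>norm z = 1; z \<noteq> -1; Re z \<noteq> 1 / 2; cubic_point z \<in> L\<rbrakk> \<Longrightarrow> z \<in> circle_zeros q"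
proof -
  obtain \<alpha> \<beta> \<gamma> where nonzero: "\<alpha> \<noteq> 0 \<or> \<beta> \<noteq> 0" and L: "L = {(x, y). \<alpha> * x + \<beta> * y = \<gamma>}"
    by (rule is_line_equation[OF assms])
  let ?q = "[:of_real \<alpha>, Complex (\<alpha> - \<gamma>) (- \<beta>), of_real (- \<gamma>):]"
  show thesis
  proof (rule that)
    show "degree ?q \<le> 2"
      by simp
    show "circle_zeros ?q \<noteq> sphere 0 1"
      using nonzero by (auto simp: circle_zeros_eq_sphere_iff complex_eq_iff split: if_splits)
    show "-1 \<in> circle_zeros ?q"
      by (simp add: circle_zeros_def)
    fix z assume z: "norm z = 1" "z \<noteq> -1" "Re z \<noteq> 1 / 2" "cubic_point z \<in> L"
    have "2 * Re z - 1 \<noteq> 0" "(\<alpha> + \<beta> * tan_half z) / (2 * Re z - 1) = \<gamma>"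
      using z(3,4) by (simp_all add: L cubic_point_def add_divide_distrib)
    then have "\<alpha> + \<beta> * tan_half z = \<gamma> * (2 * Re z - 1)"
      by (simp add: divide_eq_eq)
    then have "Re (poly ?q z) = 0"
      using tan_half_identities(2,3)[OF z(1,2)] by simp algebra
    with z(1) show "z \<in> circle_zeros ?q"
      by (simp add: circle_zeros_def)
  qed
qed

lemma conic_on_hyperbola_line:
  assumes "is_conic K"
  obtains p q where "degree p \<le> 2" "degree q \<le> 1" "coeff p 2 = coeff q 1"
    "circle_zeros p \<noteq> sphere 0 1 \<or> circle_zeros q \<noteq> sphere 0 1"
    "\<And>z. \<lbrakk>norm z = 1; Re z \<noteq> 0\<rbrakk> \<Longrightarrow> hyperbola_point z \<in> K \<longleftrightarrow> z \<in> circle_zeros p"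
    "\<And>z. \<lbrakk>norm z = 1; z \<noteq> -1\<rbrakk> \<Longrightarrow> line_point z \<in> K \<longleftrightarrow> z \<in> circle_zeros q"
proof -
  obtain a b c d e f where nonzero: "a \<noteq> 0 \<or> b \<noteq> 0 \<or> c \<noteq> 0"
    and K: "K = {(x, y). a * x\<^sup>2 + b * x * y + c * y\<^sup>2 + d * x + e * y + f = 0}"
    using assms unfolding is_conic_def by blast
  let ?p = "[:of_real (2 * a + c + f), Complex (2 * d) (- 2 * b), Complex (f - c) (- e):]"
  let ?q = "[:of_real (c + f), Complex (f - c) (- e):]"
  show thesis
  proof (rule that)
    show "degree ?p \<le> 2" "degree ?q \<le> 1" "coeff ?p 2 = coeff ?q 1"
      by (simp_all add: eval_nat_numeral)
    show "circle_zeros ?p \<noteq> sphere 0 1 \<or> circle_zeros ?q \<noteq> sphere 0 1"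
      using nonzero by (auto simp: circle_zeros_eq_sphere_iff complex_eq_iff split: if_splits)
    fix z :: complex assume z: "norm z = 1"
    show "hyperbola_point z \<in> K \<longleftrightarrow> z \<in> circle_zeros ?p" if "Re z \<noteq> 0"
    proof -
      define s where "s = 1 / Re z"
      have "s * Re z = 1" "(Re z)\<^sup>2 + (Im z)\<^sup>2 = 1"
        using z that by (simp_all add: s_def cmod_power2[symmetric])
      then have "Re (poly ?p z) = 2 * (Re z)\<^sup>2 *
          (a * s\<^sup>2 + b * s * (Im z * s) + c * (Im z * s)\<^sup>2 + d * s + e * (Im z * s) + f)"
        by simp algebra
      with z that show ?thesis
        by (simp add: circle_zeros_def K hyperbola_point_def s_def)
    qed
    show "line_point z \<in> K \<longleftrightarrow> z \<in> circle_zeros ?q" if "z \<noteq> -1"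
    proof -
      note t = tan_half_identities[OF z that]
      have "Re (poly ?q z) = (1 + Re z) * (c * (tan_half z)\<^sup>2 + e * tan_half z + f)"
        using t(2,3) by simp algebra
      with z t(1) show ?thesis
        by (simp add: circle_zeros_def K line_point_def)
    qed
  qed
qed

lemma line_on_hyperbola:
  assumes "is_line L"
  obtains p where "degree p \<le> 1" "circle_zeros p \<noteq> sphere 0 1"
    "\<And>z. \<lbrakk>norm z = 1; Re z \<noteq> 0; hyperbola_point z \<in> L\<rbrakk> \<Longrightarrow> z \<in> circle_zeros p"
proof -
  obtain \<alpha> \<beta> \<gamma> where nonzero: "\<alpha> \<noteq> 0 \<or> \<beta> \<noteq> 0" and L: "L = {(x, y). \<alpha> * x + \<beta> * y = \<gamma>}"
    by (rule is_line_equation[OF assms])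
  let ?p = "[:of_real \<alpha>, Complex (- \<gamma>) (- \<beta>):]"
  show thesis
  proof (rule that)
    show "degree ?p \<le> 1"
      by simp
    show "circle_zeros ?p \<noteq> sphere 0 1"
      using nonzero by (auto simp: circle_zeros_eq_sphere_iff complex_eq_iff split: if_splits)
    show "z \<in> circle_zeros ?p" if "norm z = 1" "Re z \<noteq> 0" "hyperbola_point z \<in> L" for z
      using that by (simp add: circle_zeros_def L hyperbola_point_def field_simps)
  qed
qed

section \<open>Counting ordinary conics\<close>

lemma card_ordinary_conics_le:
  assumes "finite F" "\<And>K. ordinary_conic S K \<Longrightarrow> K \<inter> S \<in> F"
  shows "card (ordinary_conics S) \<le> card F"
proof (rule card_inj_on_le)
  show "inj_on (\<lambda>K. K \<inter> S) (ordinary_conics S)"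
    unfolding ordinary_conics_def ordinary_conic_def by (intro inj_onI) blast
  show "(\<lambda>K. K \<inter> S) ` ordinary_conics S \<subseteq> F"
    using assms(2) by (auto simp: ordinary_conics_def)
qed (rule assms(1))

lemma binomial_le_power_div_fact: "real (n choose k) \<le> real n ^ k / fact k"
proof -
  have "real ((n choose k) * fact k) \<le> real (n ^ k)"
    using binomial_fact_pow by (rule of_nat_mono)
  then show ?thesis
    by (simp add: field_simps)
qed

text \<open>\<open>T\<close> stands for the intersection of two curves, tangent at \<open>u\<close> and transversal elsewhere: the
  product of all intersection points, counted with multiplicity, is \<open>c\<close>.\<close>

definition tangent_sets :: "'a::comm_monoid_mult set \<Rightarrow> nat \<Rightarrow> 'a \<Rightarrow> 'a set set" where
  "tangent_sets U k c = {T. T \<subseteq> U \<and> card T = Suc k \<and> (\<exists>u\<in>T. u * \<Prod>T = c)}"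

lemma finite_tangent_sets: "finite U \<Longrightarrow> finite (tangent_sets U k c)"
  by (rule finite_subset[of _ "Pow U"]) (auto simp: tangent_sets_def)

lemma card_tangent_sets_le:
  fixes U :: "'a::idom set"
  assumes "finite U" "0 \<notin> U" "inj_on (\<lambda>z. z\<^sup>2) U"
  shows "card (tangent_sets U k c) \<le> card U choose k"
proof -
  obtain u where u: "\<And>T. T \<in> tangent_sets U k c \<Longrightarrow> u T \<in> T \<and> u T * \<Prod>T = c"
    unfolding tangent_sets_def by (atomize_elim, rule bchoice[unfolded Ball_def]) blast
  have finite: "finite T" and mem_U: "u T \<in> U" and card: "card (T - {u T}) = k"
    and prod: "(u T)\<^sup>2 * \<Prod>(T - {u T}) = c"
    if "T \<in> tangent_sets U k c" for T
  proof -
    show "finite T" "u T \<in> U"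
      using that u[OF that] assms(1) by (auto simp: tangent_sets_def intro: finite_subset)
    then show "card (T - {u T}) = k" "(u T)\<^sup>2 * \<Prod>(T - {u T}) = c"
      using that u[OF that] prod.remove[of T "u T" "\<lambda>x. x"]
      by (auto simp: tangent_sets_def power2_eq_square mult.assoc)
  qed
  have "inj_on (\<lambda>T. T - {u T}) (tangent_sets U k c)"
  proof (rule inj_onI)
    fix T T' assume mem: "T \<in> tangent_sets U k c" "T' \<in> tangent_sets U k c"
      and eq: "T - {u T} = T' - {u T'}"
    have "\<Prod>(T - {u T}) \<noteq> 0"
      using finite[OF mem(1)] mem(1) assms(2) by (auto simp: tangent_sets_def)
    then have "(u T)\<^sup>2 = (u T')\<^sup>2"
      using prod[OF mem(1)] prod[OF mem(2)] unfolding eq by (metis mult_cancel_right)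
    then have "u T = u T'"
      using assms(3) mem_U mem by (auto dest: inj_onD)
    then show "T = T'"
      using eq u[OF mem(1)] u[OF mem(2)] by (metis insert_Diff)
  qed
  moreover have "(\<lambda>T. T - {u T}) ` tangent_sets U k c \<subseteq> {R. R \<subseteq> U \<and> card R = k}"
    using card by (auto simp: tangent_sets_def)
  ultimately have "card (tangent_sets U k c) \<le> card {R. R \<subseteq> U \<and> card R = k}"
    using assms(1) by (intro card_inj_on_le) auto
  then show ?thesis
    using assms(1) by (simp add: n_subsets)
qed

lemma card_Sigma_tangent_sets_le:
  fixes U :: "'a::idom set"
  assumes "finite U" "0 \<notin> U" "inj_on (\<lambda>z. z\<^sup>2) U"
  shows "card (SIGMA R:{R. R \<subseteq> U \<and> card R = j}. tangent_sets U k (\<Prod>R)) \<le>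
    (card U choose j) * (card U choose k)"
proof -
  have "card (SIGMA R:{R. R \<subseteq> U \<and> card R = j}. tangent_sets U k (\<Prod>R)) =
      (\<Sum>R | R \<subseteq> U \<and> card R = j. card (tangent_sets U k (\<Prod>R)))"
    using assms(1) by (simp add: finite_tangent_sets)
  also have "\<dots> \<le> card {R. R \<subseteq> U \<and> card R = j} * (card U choose k)"
    using card_tangent_sets_le[OF assms] by (intro sum_bounded_above[where 'a = nat, simplified]) auto
  finally show ?thesis
    using assms(1) by (simp add: n_subsets)
qed

section \<open>The roots of unity of odd order\<close>

locale odd_roots_of_unity =
  fixes n :: nat
  assumes odd_n: "odd n"
begin

definition U :: "complex set" where
  "U = {z. z ^ n = 1}"

lemma finite_U: "finite U" and card_U: "card U = n"
  using odd_pos[OF odd_n] by (simp_all add: U_def finite_roots_unity card_roots_unity_eq)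

lemma norm_U: "z \<in> U \<Longrightarrow> norm z = 1"
  using power_eq_1_iff[of z n] odd_pos[OF odd_n] by (simp add: U_def)

lemma zero_notin_U: "0 \<notin> U"
  using norm_U by force

lemma one_U: "1 \<in> U"
  by (simp add: U_def)

lemma divide_U: "z \<in> U \<Longrightarrow> w \<in> U \<Longrightarrow> z / w \<in> U"
  by (simp add: U_def power_divide)

lemma prod_U: "A \<subseteq> U \<Longrightarrow> \<Prod>A \<in> U"
  by (auto simp: U_def prod_power_distrib intro!: prod.neutral)

lemma power_U_neq_minus_one:
  assumes "z \<in> U"
  shows "z ^ k \<noteq> -1"
proof
  assume "z ^ k = -1"
  then have "(-1) ^ n = (z ^ n) ^ k"
    by (metis mult.commute power_mult)
  with assms odd_n show False
    by (simp add: U_def)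
qed

lemma U_neq_minus_one: "z \<in> U \<Longrightarrow> z \<noteq> -1"
  using power_U_neq_minus_one[of z 1] by simp

lemma Re_U_neq_0:
  assumes "z \<in> U"
  shows "Re z \<noteq> 0"
proof
  assume "Re z = 0"
  moreover have "(Re z)\<^sup>2 + (Im z)\<^sup>2 = 1"
    using norm_U[OF assms] by (simp add: cmod_power2[symmetric])
  ultimately have "z ^ 2 = -1"
    by (simp add: complex_eq_iff power2_eq_square)
  then show False
    using power_U_neq_minus_one[OF assms] by blast
qed

lemma Re_U_neq_half:
  assumes "z \<in> U"
  shows "Re z \<noteq> 1 / 2"
proof
  assume Re: "Re z = 1 / 2"
  have "(Re z)\<^sup>2 + (Im z)\<^sup>2 = 1"
    using norm_U[OF assms] by (simp add: cmod_power2[symmetric])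
  then have Im: "Im z * Im z = 3 / 4"
    unfolding Re by (simp add: power2_eq_square)
  have "z ^ 3 = -1"
    by (simp add: complex_eq_iff power3_eq_cube Re Im)
  then show False
    using power_U_neq_minus_one[OF assms] by blast
qed

lemma inj_on_square: "inj_on (\<lambda>z. z\<^sup>2) U"
proof (rule inj_onI)
  fix z w assume zw: "z \<in> U" "w \<in> U" "z\<^sup>2 = w\<^sup>2"
  have "z / w \<noteq> -1"
    using zw divide_U U_neq_minus_one by blast
  then have "z \<noteq> - w"
    using zw(2) zero_notin_U by (auto split: if_splits)
  with zw(3) show "z = w"
    by (simp add: power2_eq_iff)
qed

lemma circle_zeros_mem_tangent_sets:
  assumes "card (U \<inter> circle_zeros q) = Suc k" "2 * degree q = Suc (Suc k)"
    "c \<in> U" "lead_coeff q * c = cnj (lead_coeff q)"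
  shows "U \<inter> circle_zeros q \<in> tangent_sets U k c"
proof -
  let ?T = "U \<inter> circle_zeros q"
  obtain r where r: "r \<in> circle_zeros q" "lead_coeff q * (r * \<Prod>?T) = cnj (lead_coeff q)"
    by (rule last_circle_zero[of ?T q]) (use assms(1,2) in auto)
  have "lead_coeff q \<noteq> 0"
    using assms(2) by auto
  then have eq: "r * \<Prod>?T = c"
    using r(2) assms(4) by (metis mult_left_cancel)
  have "\<Prod>?T \<in> U"
    by (rule prod_U) simp
  then have "r = c / \<Prod>?T"
    using eq zero_notin_U by auto
  then have "r \<in> U"
    using divide_U assms(3) \<open>\<Prod>?T \<in> U\<close> by simp
  with r(1) eq assms(1) show ?thesis
    by (auto simp: tangent_sets_def)
qed

lemma circle_zeros_mem_tangent_sets_prod: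
  assumes "card (U \<inter> circle_zeros q) = Suc k" "2 * degree q = Suc (Suc k)"
    "card (U \<inter> circle_zeros p) = 2 * degree p" "0 < degree p" "lead_coeff q = lead_coeff p"
  shows "U \<inter> circle_zeros q \<in> tangent_sets U k (\<Prod>(U \<inter> circle_zeros p))"
  using assms(1,2)
proof (rule circle_zeros_mem_tangent_sets)
  show "\<Prod>(U \<inter> circle_zeros p) \<in> U"
    by (rule prod_U) simp
  show "lead_coeff q * \<Prod>(U \<inter> circle_zeros p) = cnj (lead_coeff q)"
    unfolding assms(5) using assms(3,4) by (intro prod_circle_zeros) auto
qed

section \<open>A subgroup of the acnodal cubic\<close>

lemma inj_on_cubic_point: "inj_on cubic_point U"
proof (rule inj_onI)
  fix z w assume zw: "z \<in> U" "w \<in> U" "cubic_point z = cubic_point w"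
  moreover have "2 * Re w - 1 \<noteq> 0"
    using Re_U_neq_half[OF zw(2)] by linarith
  ultimately have "tan_half z = tan_half w"
    by (auto simp: cubic_point_def)
  with zw show "z = w"
    by (intro tan_half_inject) (auto simp: norm_U U_neq_minus_one)
qed

lemma card_cubic_Int: "card (cubic_point ` U \<inter> K) = card (U \<inter> cubic_point -` K)"
proof -
  have "cubic_point ` U \<inter> K = cubic_point ` (U \<inter> cubic_point -` K)"
    by blast
  then show ?thesis
    by (simp add: card_image inj_on_subset[OF inj_on_cubic_point])
qed

lemma card_cubic: "card (cubic_point ` U) = n"
  by (simp add: card_image inj_on_cubic_point card_U)

lemma cubic_not_subset_conic:
  assumes "6 < n" "is_conic K"
  shows "\<not> cubic_point ` U \<subseteq> K"
proof
  assume subset: "cubic_point ` U \<subseteq> K"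
  obtain q where degree: "degree q \<le> 3" and proper: "circle_zeros q \<noteq> sphere 0 1"
    and zeros: "\<And>z. \<lbrakk>norm z = 1; z \<noteq> -1; Re z \<noteq> 1 / 2\<rbrakk> \<Longrightarrow> cubic_point z \<in> K \<longleftrightarrow> z \<in> circle_zeros q"
    by (rule conic_on_cubic[OF assms(2)]) blast
  have "U \<subseteq> circle_zeros q"
    using subset zeros norm_U U_neq_minus_one Re_U_neq_half by blast
  with proper have "card U \<le> 2 * degree q"
    by (rule card_circle_zeros_le)
  with degree assms(1) show False
    by (simp add: card_U)
qed

lemma card_cubic_Int_line_le:
  assumes "is_line L"
  shows "card (cubic_point ` U \<inter> L) \<le> 3"
proof -
  obtain q where degree: "degree q \<le> 2" and proper: "circle_zeros q \<noteq> sphere 0 1"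
    and minus_one: "-1 \<in> circle_zeros q"
    and zeros: "\<And>z. \<lbrakk>norm z = 1; z \<noteq> -1; Re z \<noteq> 1 / 2; cubic_point z \<in> L\<rbrakk> \<Longrightarrow> z \<in> circle_zeros q"
    by (rule line_on_cubic[OF assms]) blast
  let ?T = "U \<inter> cubic_point -` L"
  have "insert (-1) ?T \<subseteq> circle_zeros q"
    using minus_one zeros norm_U U_neq_minus_one Re_U_neq_half by auto
  with proper have "card (insert (-1) ?T) \<le> 2 * degree q"
    by (rule card_circle_zeros_le)
  moreover have "card (insert (-1) ?T) = Suc (card ?T)"
    using finite_U U_neq_minus_one by (intro card_insert_disjoint) auto
  ultimately show ?thesis
    using degree by (simp add: card_cubic_Int)
qed

lemma cubic_conic_mem_tangent_sets:
  assumes "is_conic K" "card (U \<inter> cubic_point -` K) = 5"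
  shows "U \<inter> cubic_point -` K \<in> tangent_sets U 4 1"
proof -
  obtain q where degree: "degree q \<le> 3" and real: "coeff q 3 \<in> \<real>"
    and proper: "circle_zeros q \<noteq> sphere 0 1"
    and zeros: "\<And>z. \<lbrakk>norm z = 1; z \<noteq> -1; Re z \<noteq> 1 / 2\<rbrakk> \<Longrightarrow> cubic_point z \<in> K \<longleftrightarrow> z \<in> circle_zeros q"
    by (rule conic_on_cubic[OF assms(1)]) blast
  have trace: "U \<inter> cubic_point -` K = U \<inter> circle_zeros q"
    using zeros norm_U U_neq_minus_one Re_U_neq_half by blast
  have "5 \<le> 2 * degree q"
    using card_circle_zeros_le[OF proper Int_lower2, of U] assms(2) trace by simp
  with degree have "degree q = 3"
    by linarith
  moreover from this have "lead_coeff q * 1 = cnj (lead_coeff q)"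
    using real by (simp add: Reals_cnj_iff)
  ultimately show ?thesis
    unfolding trace using assms(2) trace one_U by (intro circle_zeros_mem_tangent_sets) simp_all
qed

lemma card_ordinary_conics_cubic_le: "card (ordinary_conics (cubic_point ` U)) \<le> n choose 4"
proof -
  have "card (ordinary_conics (cubic_point ` U)) \<le> card ((`) cubic_point ` tangent_sets U 4 1)"
  proof (rule card_ordinary_conics_le)
    fix K assume "ordinary_conic (cubic_point ` U) K"
    then have "is_conic K" "card (U \<inter> cubic_point -` K) = 5"
      by (simp_all add: ordinary_conic_def Int_commute[of K] card_cubic_Int)
    then have "U \<inter> cubic_point -` K \<in> tangent_sets U 4 1"
      by (rule cubic_conic_mem_tangent_sets)
    moreover have "K \<inter> cubic_point ` U = cubic_point ` (U \<inter> cubic_point -` K)"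
      by blast
    ultimately show "K \<inter> cubic_point ` U \<in> (`) cubic_point ` tangent_sets U 4 1"
      by blast
  qed (simp add: finite_tangent_sets finite_U)
  also have "\<dots> \<le> card (tangent_sets U 4 1)"
    by (simp add: card_image_le finite_tangent_sets finite_U)
  also have "\<dots> \<le> n choose 4"
    using card_tangent_sets_le[OF finite_U zero_notin_U inj_on_square] by (simp add: card_U)
  finally show ?thesis .
qed

corollary card_ordinary_conics_cubic_le_power:
  "real (card (ordinary_conics (cubic_point ` U))) \<le> 1 / 24 * real (card (cubic_point ` U)) ^ 4"
proof -
  have "real (card (ordinary_conics (cubic_point ` U))) \<le> real (n choose 4)"
    using card_ordinary_conics_cubic_le by (rule of_nat_mono)
  also have "\<dots> \<le> real n ^ 4 / fact 4"
    by (rule binomial_le_power_div_fact)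
  finally show ?thesis
    by (simp add: card_cubic fact_numeral)
qed

section \<open>A subgroup of the union of a hyperbola and a line\<close>

lemma inj_on_hyperbola_point: "inj_on hyperbola_point U"
  by (rule inj_onI) (use Re_U_neq_0 in \<open>force simp: hyperbola_point_def complex_eq_iff\<close>)

lemma inj_on_line_point: "inj_on line_point U"
proof (rule inj_onI)
  fix z w assume "z \<in> U" "w \<in> U" "line_point z = line_point w"
  then show "z = w"
    by (intro tan_half_inject) (auto simp: norm_U U_neq_minus_one line_point_def)
qed

lemma card_hyperbola_line:
  assumes "A \<subseteq> U" "B \<subseteq> U"
  shows "card (hyperbola_line (A, B)) = card A + card B"
proof -
  have "finite A" "finite B"
    using assms finite_U finite_subset by auto
  moreover have "hyperbola_point ` A \<inter> line_point ` B = {}"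
    using assms(1) Re_U_neq_0 by (auto simp: hyperbola_point_def line_point_def)
  ultimately show ?thesis
    using assms by (simp add: hyperbola_line_def card_Un_disjoint card_image
        inj_on_subset[OF inj_on_hyperbola_point] inj_on_subset[OF inj_on_line_point])
qed

lemma hyperbola_line_Int:
  "hyperbola_line (U, U) \<inter> K = hyperbola_line (U \<inter> hyperbola_point -` K, U \<inter> line_point -` K)"
  by (auto simp: hyperbola_line_def)

lemma hyperbola_line_not_subset_conic:
  assumes "4 < n" "is_conic K"
  shows "\<not> hyperbola_line (U, U) \<subseteq> K"
proof
  assume subset: "hyperbola_line (U, U) \<subseteq> K"
  obtain p q where degree: "degree p \<le> 2" "degree q \<le> 1"
    and proper: "circle_zeros p \<noteq> sphere 0 1 \<or> circle_zeros q \<noteq> sphere 0 1"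
    and zeros: "\<And>z. \<lbrakk>norm z = 1; Re z \<noteq> 0\<rbrakk> \<Longrightarrow> hyperbola_point z \<in> K \<longleftrightarrow> z \<in> circle_zeros p"
      "\<And>z. \<lbrakk>norm z = 1; z \<noteq> -1\<rbrakk> \<Longrightarrow> line_point z \<in> K \<longleftrightarrow> z \<in> circle_zeros q"
    by (rule conic_on_hyperbola_line[OF assms(2)]) blast
  have "U \<subseteq> circle_zeros p" "U \<subseteq> circle_zeros q"
    using subset zeros norm_U U_neq_minus_one Re_U_neq_0 by (auto simp: hyperbola_line_def)
  then have "card U \<le> 2 * degree p \<or> card U \<le> 2 * degree q"
    using proper card_circle_zeros_le by blast
  with degree assms(1) show False
    by (auto simp: card_U)
qed

lemma card_hyperbola_line_Int_line_le:
  assumes "3 \<le> n" "is_line L"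
  shows "card (hyperbola_line (U, U) \<inter> L) \<le> n"
proof -
  let ?A = "U \<inter> hyperbola_point -` L" and ?B = "U \<inter> line_point -` L"
  have "card ?A + card ?B \<le> n"
  proof (rule is_line_Int_y_axis[OF assms(2)])
    assume "L = {0} \<times> UNIV"
    then have A: "?A = {}"
      using Re_U_neq_0 by (auto simp: hyperbola_point_def)
    have "card ?B \<le> card U"
      using finite_U by (intro card_mono) auto
    then show ?thesis
      unfolding A by (simp add: card_U)
  next
    fix y assume "L \<inter> {0} \<times> UNIV \<subseteq> {(0, y)}"
    then have "line_point ` ?B \<subseteq> {(0, y)}"
      by (auto simp: line_point_def)
    then have "card ?B \<le> card {(0::real, y)}"
      by (intro card_inj_on_le[of line_point]) (auto intro: inj_on_subset[OF inj_on_line_point])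
    moreover obtain p where degree: "degree p \<le> 1" and proper: "circle_zeros p \<noteq> sphere 0 1"
      and zeros: "\<And>z. \<lbrakk>norm z = 1; Re z \<noteq> 0; hyperbola_point z \<in> L\<rbrakk> \<Longrightarrow> z \<in> circle_zeros p"
      by (rule line_on_hyperbola[OF assms(2)]) blast
    have "?A \<subseteq> circle_zeros p"
      using zeros norm_U Re_U_neq_0 by auto
    with proper have "card ?A \<le> 2 * degree p"
      by (rule card_circle_zeros_le)
    ultimately show ?thesis
      using degree assms(1) by simp
  qed
  then show ?thesis
    by (simp add: hyperbola_line_Int card_hyperbola_line)
qed

lemma hyperbola_line_conic_mem_tangent_sets:
  assumes "5 < n" "is_conic K"
  defines "A \<equiv> U \<inter> hyperbola_point -` K" and "B \<equiv> U \<inter> line_point -` K"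
  assumes card_5: "card A + card B = 5"
  obtains "card A = 4" "B \<in> tangent_sets U 0 (\<Prod>A)" | "card B = 2" "A \<in> tangent_sets U 2 (\<Prod>B)"
proof -
  obtain p q where degree: "degree p \<le> 2" "degree q \<le> 1" and coeff: "coeff p 2 = coeff q 1"
    and zeros: "\<And>z. \<lbrakk>norm z = 1; Re z \<noteq> 0\<rbrakk> \<Longrightarrow> hyperbola_point z \<in> K \<longleftrightarrow> z \<in> circle_zeros p"
      "\<And>z. \<lbrakk>norm z = 1; z \<noteq> -1\<rbrakk> \<Longrightarrow> line_point z \<in> K \<longleftrightarrow> z \<in> circle_zeros q"
    by (rule conic_on_hyperbola_line[OF assms(2)]) blast
  have A: "A = U \<inter> circle_zeros p" and B: "B = U \<inter> circle_zeros q"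
    unfolding A_def B_def using zeros norm_U Re_U_neq_0 U_neq_minus_one by blast+
  have "A \<noteq> U" "B \<noteq> U"
    using card_5 card_U assms(1) by auto
  then have "circle_zeros p \<noteq> sphere 0 1" "circle_zeros q \<noteq> sphere 0 1"
    using norm_U by (auto simp: A B)
  then have "card A \<le> 2 * degree p" "card B \<le> 2 * degree q"
    by (auto simp: A B intro: card_circle_zeros_le)
  with degree card_5 have degree: "degree p = 2" "degree q = 1"
    and cases: "card A = 4 \<and> card B = 1 \<or> card A = 3 \<and> card B = 2"
    by linarith+
  have lead_coeff: "lead_coeff q = lead_coeff p"
    using coeff degree by simp
  from cases show thesis
  proof
    assume card: "card A = 4 \<and> card B = 1"
    then have "B \<in> tangent_sets U 0 (\<Prod>A)"
      unfolding A B using degree lead_coeff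
      by (intro circle_zeros_mem_tangent_sets_prod) (auto simp: A B)
    with card that(1) show thesis by blast
  next
    assume card: "card A = 3 \<and> card B = 2"
    then have "A \<in> tangent_sets U 2 (\<Prod>B)"
      unfolding A B using degree lead_coeff
      by (intro circle_zeros_mem_tangent_sets_prod) (auto simp: A B)
    with card that(2) show thesis by blast
  qed
qed

lemma card_ordinary_conics_hyperbola_line_le:
  assumes "5 < n"
  shows "card (ordinary_conics (hyperbola_line (U, U))) \<le> (n choose 4) + (n choose 2)\<^sup>2"
proof -
  let ?Sigma = "\<lambda>j k. SIGMA R:{R. R \<subseteq> U \<and> card R = j}. tangent_sets U k (\<Prod>R)"
  let ?F = "?Sigma 4 0 \<union> (?Sigma 2 2)\<inverse>"
  have finite: "finite (?Sigma j k)" for j k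
    by (intro finite_SigmaI) (auto simp: finite_U finite_tangent_sets)
  have card: "card (?Sigma j k) \<le> (n choose j) * (n choose k)" for j k
    using card_Sigma_tangent_sets_le[OF finite_U zero_notin_U inj_on_square] by (simp add: card_U)
  have "card (ordinary_conics (hyperbola_line (U, U))) \<le> card (hyperbola_line ` ?F)"
  proof (rule card_ordinary_conics_le)
    show "finite (hyperbola_line ` ?F)"
      using finite by simp
    fix K assume K: "ordinary_conic (hyperbola_line (U, U)) K"
    let ?A = "U \<inter> hyperbola_point -` K" and ?B = "U \<inter> line_point -` K"
    have trace: "K \<inter> hyperbola_line (U, U) = hyperbola_line (?A, ?B)"
      by (simp add: Int_commute[of K] hyperbola_line_Int)
    with K have "is_conic K" "card ?A + card ?B = 5"
      by (simp_all add: ordinary_conic_def card_hyperbola_line)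
    with assms have "(?A, ?B) \<in> ?F"
      by (elim hyperbola_line_conic_mem_tangent_sets) auto
    then show "K \<inter> hyperbola_line (U, U) \<in> hyperbola_line ` ?F"
      unfolding trace by (rule imageI)
  qed
  also have "\<dots> \<le> card ?F"
    using finite by (intro card_image_le) simp
  also have "\<dots> \<le> card (?Sigma 4 0) + card (?Sigma 2 2)"
    using card_Un_le[of "?Sigma 4 0" "(?Sigma 2 2)\<inverse>"] by simp
  also have "\<dots> \<le> (n choose 4) + (n choose 2)\<^sup>2"
    using add_mono[OF card[of 4 0] card[of 2 2]] by (simp add: power2_eq_square)
  finally show ?thesis .
qed

corollary card_ordinary_conics_hyperbola_line_le_power:
  assumes "5 < n"
  shows "real (card (ordinary_conics (hyperbola_line (U, U)))) \<le>
    7 / 384 * real (card (hyperbola_line (U, U))) ^ 4"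
proof -
  have "real (card (ordinary_conics (hyperbola_line (U, U)))) \<le> real ((n choose 4) + (n choose 2)\<^sup>2)"
    using card_ordinary_conics_hyperbola_line_le[OF assms] by (rule of_nat_mono)
  also have "\<dots> = real (n choose 4) + (real (n choose 2))\<^sup>2"
    by simp
  also have "\<dots> \<le> real n ^ 4 / fact 4 + (real n ^ 2 / fact 2)\<^sup>2"
    by (intro add_mono power_mono binomial_le_power_div_fact) simp
  also have "\<dots> = 7 / 384 * real (n + n) ^ 4"
    by (simp add: fact_numeral power_divide power_mult_distrib flip: power_mult mult_2)
  finally show ?thesis
    by (simp only: card_hyperbola_line[OF order_refl order_refl] card_U)
qed

end

theorem theorem1p2:
  shows "(\<forall>N :: nat. \<exists>S :: (real \<times> real) set.
            finite S \<and> card S \<ge> N \<and>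
            \<not> (\<exists>K. is_conic K \<and> S \<subseteq> K) \<and>
            \<not> (\<exists>L. is_line L \<and> card (S \<inter> L) \<ge> 4) \<and>
            real (card (ordinary_conics S)) \<le> 1 / 24 * real (card S) ^ 4)
       \<and> (\<exists>C :: real. \<forall>N :: nat. \<exists>S :: (real \<times> real) set.
            finite S \<and> card S \<ge> N \<and>
            \<not> (\<exists>K. is_conic K \<and> S \<subseteq> K) \<and>
            (\<forall>L. is_line L \<longrightarrow> real (card (S \<inter> L)) \<le> real (card S) / 2) \<and>
            real (card (ordinary_conics S)) \<le> 7 / 384 * real (card S) ^ 4 + C * real (card S) ^ 3)"
proof (intro conjI exI[of _ "0::real"] allI, goal_cases)
  case (1 N)
  interpret odd_roots_of_unity "2 * N + 7" by unfold_locales simp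
  let ?S = "cubic_point ` U"
  have "\<not> 4 \<le> card (?S \<inter> L)" if "is_line L" for L
    using card_cubic_Int_line_le[OF that] by linarith
  moreover have "\<not> ?S \<subseteq> K" if "is_conic K" for K
    using cubic_not_subset_conic[OF _ that] by simp
  ultimately show ?case
    using finite_U card_cubic card_ordinary_conics_cubic_le_power by (intro exI[of _ ?S]) auto
next
  case (2 N)
  interpret odd_roots_of_unity "2 * N + 7" by unfold_locales simp
  let ?S = "hyperbola_line (U, U)"
  have card_S: "card ?S = 2 * (2 * N + 7)"
    by (simp add: card_hyperbola_line card_U)
  have "real (card (?S \<inter> L)) \<le> real (card ?S) / 2" if "is_line L" for L
    using card_hyperbola_line_Int_line_le[OF _ that] by (simp add: card_S)
  moreover have "\<not> ?S \<subseteq> K" if "is_conic K" for K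
    using hyperbola_line_not_subset_conic[OF _ that] by simp
  moreover have "finite ?S"
    by (rule card_ge_0_finite) (simp add: card_S)
  ultimately show ?case
    using card_S card_ordinary_conics_hyperbola_line_le_power by (intro exI[of _ ?S]) auto
qed

end
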